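(* Let $k<m$. Let $\mathbf{M}\in\mathbb{R}^{m\times m}$ be diagonal with positive diagonal entries, let $\mathbf{K}\in\mathbb{R}^{m\times m}$ be symmetric positive semi-definite, and let $\mathbf{C}=a_1\mathbf{M}+a_2\mathbf{K}$ with $a_1\ge 0$, $a_2\ge 0$ (so $\mathbf{C}$ is also symmetric positive semi-definite). Let $\mathbf{V}_M\in\mathbb{R}^{m\times k}$ be a reduced basis with $\mathbf{M}$-orthonormal columns, i.e. $\mathbf{V}_M^T\mathbf{M}\mathbf{V}_M=\mathbf{I}$, $\mathbf{V}_M=\mathbf{M}^{-1/2}\mathbf{V}$ and $\mathbf{V}^T\mathbf{V}=\mathbf{I}$. Let the full-order model (FOM) be the linearized system $$\mathbf{M}\ddot{\mathbf{x}}+\mathbf{C}\dot{\mathbf{x}}+\mathbf{K}\mathbf{x}=\mathbf{f}_{\mathrm{ext}},\qquad \mathbf{x}(t)\in\mathbb{R}^m,$$ and let the reduced-order model (ROM) be the corresponding Galerkin reduced-order model with reduced basis $\mathbf{V}_M$, $$\ddot{\tilde{\mathbf{x}}}+\mathbf{V}_M^T\mathbf{C}\mathbf{V}_M\dot{\tilde{\mathbf{x}}}+\mathbf{V}_M^T\mathbf{K}\mathbf{V}_M\tilde{\mathbf{x}}=\mathbf{V}_M^T\mathbf{f}_{\mathrm{ext}},\qquad \tilde{\mathbf{x}}(t)\in\mathbb{R}^k.$$ Apply the explicit central difference scheme to integrate both the FOM and the ROM. Then: (1) The critical time step $\Delta t_{crit}^{ROM}$ of the ROM cannot be smaller than the critical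 time step $\Delta t_{crit}^{FOM}$ of the FOM: $$\Delta t_{crit}^{ROM}\ge \Delta t_{crit}^{FOM}.$$ (2) The critical time step of the ROM is given by $$\Delta t_{crit}^{ROM}=\frac{2}{\sqrt{\tilde\mu_k^{ROM}}}\left(\sqrt{\tilde\xi_k^2+1}-\tilde\xi_k\right),\qquad \tilde\xi_k=\frac{a_1}{2\sqrt{\tilde\mu_k^{ROM}}}+\frac{a_2\sqrt{\tilde\mu_k^{ROM}}}{2},$$ where $\tilde\mu_k^{ROM}$ is the largest eigenvalue of the matrix $\mathbf{V}^T\mathbf{M}^{-1/2}\mathbf{K}\mathbf{M}^{-1/2}\mathbf{V}$. These statements hold regardless of the exact modal content of $\mathbf{V}$, and regardless of whether $\mathbf{V}$ was obtained from a singular value decomposition of displacement, acceleration, or other snapshots.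
   Context: Central difference scheme (with velocity lag): for a system $\mathbf{M}\ddot{\mathbf{x}}+\mathbf{C}\dot{\mathbf{x}}+\mathbf{K}\mathbf{x}=\mathbf{f}_{\mathrm{ext}}$ with constant matrices and constant time step $\Delta t>0$, the scheme is $$\mathbf{M}\,\frac{\mathbf{x}^{n+1}-2\mathbf{x}^n+\mathbf{x}^{n-1}}{\Delta t^2}+\mathbf{C}\,\frac{\mathbf{x}^n-\mathbf{x}^{n-1}}{\Delta t}+\mathbf{K}\mathbf{x}^n=\mathbf{f}_{\mathrm{ext}}^n .$$ For the ROM, the mass, damping and stiffness matrices are $\mathbf{I}_k$, $\mathbf{V}_M^T\mathbf{C}\mathbf{V}_M=a_1\mathbf{I}_k+a_2\mathbf{V}_M^T\mathbf{K}\mathbf{V}_M$ and $\mathbf{V}_M^T\mathbf{K}\mathbf{V}_M$. Critical time step: numerical stability is only defined for stable linear systems (small perturbations of the initial conditions lead to perturbations of the solution that stay bounded by a constant multiple for all times). A scheme is conditionally stable if it is numerically stable (perturbations of the numerical solution stay bounded) only when the time step satisfies an upper bound; this problem-dependent upper bound on the admissible time step is the critical time step $\Delta t_{crit}$. Stability criterion: if one step of a scheme is multiplication by an amplification matrix $\mathbf{A}$ (plus a forcing term), it is stable if all eigenvalues of $\mathbf{A}$ have modulus at most $1$ and every eigenvalue of modulus $1$ has algebraic multiplicity $1$. With $\mathbf{C}=a_1\mathbf{M}+a_2\mathbf{K}$ the system decouples into scalar modal equations, one for each eigenvalue $\mu_j$ of (mass matrix)$^{-1}$(stiffness matrix), and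 the criterion is applied to each of them. With $2\xi_j\sqrt{\mu_j}=a_1+a_2\mu_j$, the scheme maps $(\tilde x^n,\tilde x^{n-1})$ to $(\tilde x^{n+1},\tilde x^{n})$ with amplification matrix $$\mathbf{A}_j=\begin{bmatrix}2-2\xi_j\sqrt{\mu_j}\,\Delta t-\Delta t^2\mu_j & 2\xi_j\sqrt{\mu_j}\,\Delta t-1\\ 1&0\end{bmatrix}.$$ The critical time step of the system is $\Delta t_{crit}=\min_j\Delta t_{crit,j}$, where $\Delta t_{crit,j}$ is the critical value for the $j$-th modal equation, so that every $0<\Delta t<\Delta t_{crit}$ satisfies the stability criterion for all modal equations. *)

theory Defs
  imports "HOL-Analysis.Analysis" "HOL-Computational_Algebra.Polynomial"
begin

section \<open>Matrices\<close>

definition diagonal :: "'a::zero^'n^'n \<Rightarrow> bool" where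
  "diagonal A \<longleftrightarrow> (\<forall>i j. i \<noteq> j \<longrightarrow> A $ i $ j = 0)"

definition sym_pos_semidef :: "real^'n^'n \<Rightarrow> bool" where
  "sym_pos_semidef A \<longleftrightarrow> transpose A = A \<and> (\<forall>x. 0 \<le> x \<bullet> (A *v x))"

text \<open>The matrix \<open>M\<^sup>-\<^sup>1\<^sup>/\<^sup>2\<close>, for a diagonal matrix \<open>M\<close> with positive diagonal entries only.\<close>

definition diag_inv_sqrt :: "real^'n^'n \<Rightarrow> real^'n^'n" where
  "diag_inv_sqrt M = (\<chi> i j. if i = j then 1 / sqrt (M $ i $ i) else 0)"

definition eigenvalues :: "'a::field^'n^'n \<Rightarrow> 'a set" where
  "eigenvalues A = {\<mu>. \<exists>v. v \<noteq> 0 \<and> A *v v = \<mu> *s v}"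

definition charpoly :: "'a::comm_ring_1^'n^'n \<Rightarrow> 'a poly" where
  "charpoly A = det (mat [:0, 1:] - map_matrix (\<lambda>a. [:a:]) A)"

definition algebraic_multiplicity :: "'a::field^'n^'n \<Rightarrow> 'a \<Rightarrow> nat" where
  "algebraic_multiplicity A \<mu> = order \<mu> (charpoly A)"

section \<open>Linear second-order systems\<close>

text \<open>\<open>x\<close> is a displacement on \<open>[0,\<infinity>)\<close> with velocity \<open>v\<close> and load \<open>f\<close>.\<close>

definition system_solution ::
  "real^'n^'n \<Rightarrow> real^'n^'n \<Rightarrow> real^'n^'n \<Rightarrow> (real \<Rightarrow> real^'n) \<Rightarrow>
   (real \<Rightarrow> real^'n) \<Rightarrow> (real \<Rightarrow> real^'n) \<Rightarrow> bool" where
  "system_solution M C K f x v \<longleftrightarrow>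
     (\<forall>t\<ge>0. (x has_vector_derivative v t) (at t within {0..}) \<and>
        (\<exists>a. (v has_vector_derivative a) (at t within {0..}) \<and>
             M *v a + C *v v t + K *v x t = f t))"

definition stable_system :: "real^'n^'n \<Rightarrow> real^'n^'n \<Rightarrow> real^'n^'n \<Rightarrow> bool" where
  "stable_system M C K \<longleftrightarrow>
     (\<exists>\<delta>>0. \<exists>B. \<forall>f x v y w.
        system_solution M C K f x v \<longrightarrow> system_solution M C K f y w \<longrightarrow>
        norm (x 0 - y 0) + norm (v 0 - w 0) < \<delta> \<longrightarrow>
        (\<forall>t\<ge>0. norm (x t - y t) \<le> B * (norm (x 0 - y 0) + norm (v 0 - w 0))))"

section \<open>The central difference scheme\<close>

definition central_difference ::
  "real^'n^'n \<Rightarrow> real^'n^'n \<Rightarrow> real^'n^'n \<Rightarrow> (nat \<Rightarrow> real^'n) \<Rightarrow> real \<Rightarrow> (nat \<Rightarrow> real^'n) \<Rightarrow> bool"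
  where
  "central_difference M C K f dt x \<longleftrightarrow>
     (\<forall>n\<ge>1. M *v ((1 / dt\<^sup>2) *\<^sub>R (x (n + 1) - 2 *\<^sub>R x n + x (n - 1))) +
            C *v ((1 / dt) *\<^sub>R (x n - x (n - 1))) + K *v x n = f n)"

text \<open>
  A modal equation \<open>q'' + c q' + \<mu> q = g\<close> is represented by the pair \<open>(\<mu>, c)\<close>. With the modal
  damping ratio \<open>\<xi>\<close> one has \<open>c = 2 \<xi> sqrt \<mu>\<close>; keeping \<open>c\<close> also covers modes with \<open>\<mu> = 0\<close>, where
  \<open>\<xi>\<close> is not defined. For \<open>C = a\<^sub>1 M + a\<^sub>2 K\<close> there is exactly one modal equation for every eigenvalue
  of \<open>M\<^sup>-\<^sup>1 K\<close>, see \<open>modal_equations_Rayleigh\<close> below; the definition is not meant for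
  dampings that are not diagonalised by the undamped modes.
\<close>

definition modal_equations ::
  "real^'n^'n \<Rightarrow> real^'n^'n \<Rightarrow> real^'n^'n \<Rightarrow> (real \<times> real) set" where
  "modal_equations M C K =
     {(\<mu>, c). \<exists>\<phi>. \<phi> \<noteq> 0 \<and> (matrix_inv M ** K) *v \<phi> = \<mu> *s \<phi> \<and> (matrix_inv M ** C) *v \<phi> = c *s \<phi>}"

definition amplification_matrix :: "real \<Rightarrow> real \<Rightarrow> real \<Rightarrow> real^2^2" where
  "amplification_matrix \<mu> c dt =
     vector [vector [2 - c * dt - dt\<^sup>2 * \<mu>, c * dt - 1],
             vector [1, 0]]"

definition stability_criterion :: "real^'n^'n \<Rightarrow> bool" where
  "stability_criterion A \<longleftrightarrow>
     (let A' = map_matrix complex_of_real A in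
      \<forall>z\<in>eigenvalues A'. cmod z \<le> 1 \<and> (cmod z = 1 \<longrightarrow> algebraic_multiplicity A' z = 1))"

definition modal_critical_time_step :: "real \<Rightarrow> real \<Rightarrow> real \<Rightarrow> bool" where
  "modal_critical_time_step \<mu> c T \<longleftrightarrow>
     T > 0 \<and>
     (\<forall>dt. 0 < dt \<and> dt < T \<longrightarrow> stability_criterion (amplification_matrix \<mu> c dt)) \<and>
     (\<forall>dt. T < dt \<longrightarrow> \<not> stability_criterion (amplification_matrix \<mu> c dt))"

text \<open>
  The critical time step of a system is the minimum of those of its modal equations. It is a relation,
  so that stating it includes that all these critical values exist; uniqueness is
  \<open>has_critical_time_step_unique\<close> below.
\<close>

definition has_critical_time_step ::
  "real^'n^'n \<Rightarrow> real^'n^'n \<Rightarrow> real^'n^'n \<Rightarrow> real \<Rightarrow> bool" where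
  "has_critical_time_step M C K T \<longleftrightarrow>
     (\<exists>(\<mu>, c)\<in>modal_equations M C K. modal_critical_time_step \<mu> c T) \<and>
     (\<forall>(\<mu>, c)\<in>modal_equations M C K. \<exists>T'\<ge>T. modal_critical_time_step \<mu> c T')"

section \<open>Consistency of the definitions\<close>

lemma modal_equations_Rayleigh:
  fixes M C K :: "real^'n^'n"
  assumes "invertible M" and "C = a1 *\<^sub>R M + a2 *\<^sub>R K"
  shows "modal_equations M C K = (\<lambda>\<mu>. (\<mu>, a1 + a2 * \<mu>)) ` eigenvalues (matrix_inv M ** K)"
proof -
  have inv: "matrix_inv M ** M = mat 1"
    using someI_ex[OF assms(1)[unfolded invertible_def]] by (simp add: matrix_inv_def)
  have "matrix_inv M ** C = a1 *\<^sub>R mat 1 + a2 *\<^sub>R (matrix_inv M ** K)"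
  proof -
    have "A ** (a *\<^sub>R B) = a *\<^sub>R (A ** B)" for a :: real and A B :: "real^'n^'n"
      by (simp add: vec_eq_iff matrix_matrix_mult_def sum_distrib_left mult.left_commute)
    then show ?thesis
      unfolding assms(2) by (simp add: matrix_add_ldistrib inv)
  qed
  then have C: "(matrix_inv M ** C) *v \<phi> = a1 *\<^sub>R \<phi> + a2 *\<^sub>R ((matrix_inv M ** K) *v \<phi>)" for \<phi>
    by (simp add: matrix_vector_mult_add_rdistrib scaleR_matrix_vector_assoc[symmetric])
  show ?thesis
    unfolding modal_equations_def eigenvalues_def
    by (auto simp: C scalar_mult_eq_scaleR image_iff simp flip: scaleR_left_distrib)
qed

text \<open>One step of the scheme in the modal coordinate \<open>\<phi>\<^sup>T M x\<close> is multiplication by the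
  amplification matrix plus a forcing term.\<close>

lemma central_difference_modal:
  fixes M C K :: "real^'n^'n"
  assumes "central_difference M C K f dt x" and "dt > 0"
    and sym: "transpose M = M" "transpose C = C" "transpose K = K"
    and mode: "K *v \<phi> = \<mu> *s (M *v \<phi>)" "C *v \<phi> = c *s (M *v \<phi>)"
    and q: "\<And>n. q n = \<phi> \<bullet> (M *v x n)" and n: "n \<ge> 1"
  shows "(vector [q (n + 1), q n] :: real^2) =
    amplification_matrix \<mu> c dt *v vector [q n, q (n - 1)] + vector [dt\<^sup>2 * (\<phi> \<bullet> f n), 0]"
proof -
  have dual: "\<phi> \<bullet> (A *v y) = (A *v \<phi>) \<bullet> y" if "transpose A = A" for A :: "real^'n^'n" and y
    using that by (metis dot_lmul_matrix vector_transpose_matrix)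
  have q': "q k = (M *v \<phi>) \<bullet> x k" for k
    by (simp add: q dual[OF sym(1)])
  have "\<phi> \<bullet> (M *v ((1 / dt\<^sup>2) *\<^sub>R (x (n + 1) - 2 *\<^sub>R x n + x (n - 1))) +
            C *v ((1 / dt) *\<^sub>R (x n - x (n - 1))) + K *v x n) = \<phi> \<bullet> f n"
    using assms(1) n unfolding central_difference_def by metis
  then have "(q (n + 1) - 2 * q n + q (n - 1)) / dt\<^sup>2 + c * (q n - q (n - 1)) / dt + \<mu> * q n
      = \<phi> \<bullet> f n"
    unfolding inner_add_right dual[OF sym(1)] dual[OF sym(2)] dual[OF sym(3)] mode q'
    by (simp add: scalar_mult_eq_scaleR inner_diff_right inner_add_right diff_divide_distrib
        add_divide_distrib right_diff_distrib)
  then have "dt\<^sup>2 * ((q (n + 1) - 2 * q n + q (n - 1)) / dt\<^sup>2 + c * (q n - q (n - 1)) / dt + \<mu> * q n)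
      = dt\<^sup>2 * (\<phi> \<bullet> f n)"
    by simp
  moreover have "dt\<^sup>2 * ((q (n + 1) - 2 * q n + q (n - 1)) / dt\<^sup>2 + c * (q n - q (n - 1)) / dt + \<mu> * q n)
      = q (n + 1) - 2 * q n + q (n - 1) + c * dt * (q n - q (n - 1)) + dt\<^sup>2 * \<mu> * q n"
    using \<open>dt > 0\<close> by (simp add: field_simps power2_eq_square)
  ultimately have "q (n + 1) = (2 - c * dt - dt\<^sup>2 * \<mu>) * q n + (c * dt - 1) * q (n - 1) + dt\<^sup>2 * (\<phi> \<bullet> f n)"
    by (simp add: algebra_simps)
  then show ?thesis
    by (simp add: vec_eq_iff forall_2 amplification_matrix_def matrix_vector_mult_def sum_2)
qed

lemma modal_critical_time_step_unique:
  assumes "modal_critical_time_step \<mu> c T" and "modal_critical_time_step \<mu> c T'"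
  shows "T = T'"
proof -
  have "\<not> S < S'" if "modal_critical_time_step \<mu> c S" "modal_critical_time_step \<mu> c S'" for S S'
  proof
    assume "S < S'"
    then obtain dt where "S < dt" "dt < S'"
      using dense by blast
    then show False
      using that unfolding modal_critical_time_step_def by (meson less_trans)
  qed
  then show ?thesis
    using assms by (meson linorder_neqE)
qed

lemma has_critical_time_step_unique:
  assumes "has_critical_time_step M C K T" and "has_critical_time_step M C K T'"
  shows "T = T'"
proof -
  have "S' \<le> S" if "has_critical_time_step M C K S" "has_critical_time_step M C K S'" for S S'
    using that modal_critical_time_step_unique unfolding has_critical_time_step_def by fastforce
  then show ?thesis
    using assms by (meson order_antisym)
qed

lemma has_critical_time_step_stable:
  assumes "has_critical_time_step M C K T" and "0 < dt" "dt < T"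
    and "(\<mu>, c) \<in> modal_equations M C K"
  shows "stability_criterion (amplification_matrix \<mu> c dt)"
  using assms unfolding has_critical_time_step_def modal_critical_time_step_def by fastforce

end

theory Submission
  imports Defs
begin

text \<open>
  The characteristic polynomial \<open>z\<^sup>2 - (2 - c h - h\<^sup>2 \<mu>) z + (1 - c h)\<close> of a modal amplification
  matrix has value \<open>4 - 2 c h - h\<^sup>2 \<mu>\<close> at \<open>-1\<close>; stability is lost exactly when this becomes
  negative, that is, when \<open>h\<close> exceeds the positive root \<open>4 / (c + sqrt (c\<^sup>2 + 4 \<mu>))\<close>. This root
  decreases in \<open>\<mu>\<close> and in \<open>c = a\<^sub>1 + a\<^sub>2 \<mu>\<close>, so the largest eigenvalue determines the critical time
  step. By the Rayleigh principle, the compression \<open>V\<^sup>T A V\<close> of the symmetric matrix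
  \<open>A = M\<^sup>-\<^sup>1\<^sup>/\<^sup>2 K M\<^sup>-\<^sup>1\<^sup>/\<^sup>2\<close>, which is similar to \<open>M\<^sup>-\<^sup>1 K\<close>, has no larger eigenvalue than \<open>A\<close>.
  Stability of the continuous system excludes undamped rigid body modes, for which no time step is
  admissible.
\<close>

section \<open>Eigenvalues of symmetric matrices\<close>

lemma inner_symmetric_matrix:
  fixes A :: "real^'n^'n"
  assumes "transpose A = A"
  shows "x \<bullet> (A *v y) = (A *v x) \<bullet> y"
  using assms by (metis dot_lmul_matrix vector_transpose_matrix)

text \<open>A semi-definite form that vanishes at \<open>v\<close> is minimal there, but a small
  move in the direction \<open>- (A *v v)\<close> would make it negative to first order.\<close>

lemma sym_pos_semidef_kernel:
  fixes A :: "real^'n^'n"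
  assumes A: "sym_pos_semidef A" and v: "v \<bullet> (A *v v) = 0"
  shows "A *v v = 0"
proof (rule ccontr)
  assume "A *v v \<noteq> 0"
  define w where "w = A *v v"
  define b where "b = w \<bullet> (A *v w)"
  have sym: "transpose A = A" and pos: "0 \<le> x \<bullet> (A *v x)" for x
    using A by (auto simp: sym_pos_semidef_def)
  have w: "0 < w \<bullet> w"
    using \<open>A *v v \<noteq> 0\<close> by (simp add: w_def)
  have b: "0 \<le> b"
    using pos by (simp add: b_def)
  have "v \<bullet> (A *v w) = w \<bullet> w"
    by (simp add: inner_symmetric_matrix[OF sym] w_def)
  then have expand: "(v - t *\<^sub>R w) \<bullet> (A *v (v - t *\<^sub>R w)) = t\<^sup>2 * b - 2 * t * (w \<bullet> w)" for t
    using v by (simp add: matrix_vector_mult_diff_distrib matrix_vector_mult_scaleR inner_diff_left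
        inner_diff_right b_def power2_eq_square algebra_simps flip: w_def)
  \<comment> \<open>Any \<open>t\<close> strictly between 0 and
    \<open>2 * (w \<bullet> w) / b\<close> makes the expansion negative; the added 1 in the
    denominator covers \<open>b = 0\<close>.\<close>
  define t where "t = (w \<bullet> w) / (b + 1)"
  have t: "t > 0" "t * b < 2 * (w \<bullet> w)"
    using w b by (simp_all add: t_def field_simps add_strict_increasing2)
  have "t * (t * b - 2 * (w \<bullet> w)) < 0"
    using t by (simp add: mult_less_0_iff)
  moreover have "t * (t * b - 2 * (w \<bullet> w)) = t\<^sup>2 * b - 2 * t * (w \<bullet> w)"
    by (simp add: power2_eq_square algebra_simps)
  ultimately show False
    using pos[of "v - t *\<^sub>R w"] expand[of t] by linarith
qed

text \<open>Eigenvectors for distinct eigenvalues are orthogonal, hence independent. Finiteness is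
  what gives \<open>Max (eigenvalues A)\<close> its meaning.\<close>

lemma finite_eigenvalues_symmetric:
  fixes A :: "real^'n^'n"
  assumes sym: "transpose A = A"
  shows "finite (eigenvalues A)"
proof -
  have "\<forall>\<mu>\<in>eigenvalues A. \<exists>v. v \<noteq> 0 \<and> A *v v = \<mu> *s v"
    by (simp add: eigenvalues_def)
  then obtain v where "\<forall>\<mu>\<in>eigenvalues A. v \<mu> \<noteq> 0 \<and> A *v v \<mu> = \<mu> *s v \<mu>"
    by (auto dest!: bchoice)
  then have v: "v \<mu> \<noteq> 0 \<and> A *v v \<mu> = \<mu> *s v \<mu>" if "\<mu> \<in> eigenvalues A" for \<mu>
    using that by blast
  have orth: "v \<mu> \<bullet> v \<nu> = 0" if "\<mu> \<in> eigenvalues A" "\<nu> \<in> eigenvalues A" "\<mu> \<noteq> \<nu>" for \<mu> \<nu>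
  proof -
    have "\<nu> * (v \<mu> \<bullet> v \<nu>) = \<mu> * (v \<mu> \<bullet> v \<nu>)"
      using inner_symmetric_matrix[OF sym, of "v \<mu>" "v \<nu>"] v[OF that(1)] v[OF that(2)]
      by (simp add: scalar_mult_eq_scaleR)
    with that(3) show ?thesis by simp
  qed
  have inj: "inj_on v (eigenvalues A)"
    using orth v by (metis inj_onI inner_eq_zero_iff)
  have "pairwise orthogonal (v ` eigenvalues A)"
    using orth by (auto simp: pairwise_def orthogonal_def)
  moreover have "0 \<notin> v ` eigenvalues A"
    using v by fastforce
  ultimately have "independent (v ` eigenvalues A)"
    by (rule pairwise_orthogonal_independent)
  then have "finite (v ` eigenvalues A)"
    using independent_bound by blast
  then show ?thesis
    using inj finite_imageD by blast
qed

lemma eigenvalue_le_Rayleigh_bound: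
  fixes A :: "real^'n^'n"
  assumes "\<And>x. x \<bullet> (A *v x) \<le> b * (x \<bullet> x)" and "\<mu> \<in> eigenvalues A"
  shows "\<mu> \<le> b"
proof -
  obtain v where "v \<noteq> 0" "A *v v = \<mu> *s v"
    using assms(2) by (auto simp: eigenvalues_def)
  then show ?thesis
    using assms(1)[of v] by (simp add: scalar_mult_eq_scaleR)
qed

lemma eigenvalue_nonneg:
  fixes A :: "real^'n^'n"
  assumes "sym_pos_semidef A" and "\<mu> \<in> eigenvalues A"
  shows "0 \<le> \<mu>"
proof -
  obtain v where "v \<noteq> 0" "A *v v = \<mu> *s v"
    using assms(2) by (auto simp: eigenvalues_def)
  moreover have "0 \<le> v \<bullet> (A *v v)"
    using assms(1) by (simp add: sym_pos_semidef_def)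
  ultimately show ?thesis
    by (metis inner_gt_zero_iff inner_scaleR_right scalar_mult_eq_scaleR zero_le_mult_iff not_le)
qed

text \<open>Variational argument: the quadratic form attains a maximum \<open>b\<close> on the unit
  sphere, and a maximiser is an eigenvector for \<open>b\<close>. In particular there is a real
  eigenvalue.\<close>

lemma max_eigenvalue_symmetric:
  fixes A :: "real^'n^'n"
  assumes sym: "transpose A = A"
  shows "Max (eigenvalues A) \<in> eigenvalues A"
    and "x \<bullet> (A *v x) \<le> Max (eigenvalues A) * (x \<bullet> x)"
proof -
  have "continuous_on (sphere 0 1) (\<lambda>x. x \<bullet> (A *v x))"
    by (intro continuous_intros linear_continuous_on bounded_linear.linear linear_linear[THEN iffD2]
        matrix_vector_mul_bounded_linear)
  moreover have "sphere 0 1 \<noteq> ({} :: (real^'n) set)"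
    by simp
  ultimately obtain v where v: "v \<in> sphere 0 1"
    and max: "\<And>y. y \<in> sphere 0 1 \<Longrightarrow> y \<bullet> (A *v y) \<le> v \<bullet> (A *v v)"
    using continuous_attains_sup[OF compact_sphere] that by blast
  define b where "b = v \<bullet> (A *v v)"
  have vv: "v \<bullet> v = 1"
    using v by (simp add: dot_square_norm)
  have bound: "x \<bullet> (A *v x) \<le> b * (x \<bullet> x)" for x
  proof (cases "x = 0")
    case False
    then have "((1 / norm x) *\<^sub>R x) \<bullet> (A *v ((1 / norm x) *\<^sub>R x)) \<le> b"
      unfolding b_def by (intro max) simp
    then show ?thesis
      using False by (simp add: matrix_vector_mult_scaleR dot_square_norm power2_eq_square field_simps)
  qed simp
  \<comment> \<open>\<open>B\<close> is positive semi-definite and its form vanishes at the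
    maximiser \<open>v\<close>, so \<open>sym_pos_semidef_kernel\<close> turns maximality into the
    eigenvalue equation.\<close>
  define B where "B = b *\<^sub>R mat 1 - A"
  have B: "B *v y = b *\<^sub>R y - A *v y" for y
    by (simp add: B_def matrix_vector_mult_diff_rdistrib flip: scaleR_matrix_vector_assoc)
  have "transpose B = B"
    using sym by (auto simp: B_def transpose_def vec_eq_iff mat_def)
  then have "sym_pos_semidef B"
    using bound by (simp add: sym_pos_semidef_def B inner_diff_right)
  then have "B *v v = 0"
    by (rule sym_pos_semidef_kernel) (simp add: B inner_diff_right vv b_def)
  then have b: "b \<in> eigenvalues A"
    using vv by (auto simp: eigenvalues_def B scalar_mult_eq_scaleR intro!: exI[of _ v])
  have "Max (eigenvalues A) = b"
    using eigenvalue_le_Rayleigh_bound[OF bound] b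
    by (intro Max_eqI finite_eigenvalues_symmetric[OF sym])
  with b bound show "Max (eigenvalues A) \<in> eigenvalues A"
    and "x \<bullet> (A *v x) \<le> Max (eigenvalues A) * (x \<bullet> x)"
    by simp_all
qed

section \<open>Compressions of quadratic forms\<close>

lemma inner_compression:
  fixes A :: "real^'n^'n" and V :: "real^'k^'n"
  shows "x \<bullet> ((transpose V ** A ** V) *v x) = (V *v x) \<bullet> (A *v (V *v x))"
proof -
  have "(transpose V ** A ** V) *v x = transpose V *v (A *v (V *v x))"
    by (simp add: matrix_vector_mul_assoc matrix_mul_assoc)
  then show ?thesis
    by (metis dot_lmul_matrix vector_transpose_matrix)
qed

lemma sym_pos_semidef_compression:
  fixes A :: "real^'n^'n" and V :: "real^'k^'n"
  assumes "sym_pos_semidef A"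
  shows "sym_pos_semidef (transpose V ** A ** V)"
  using assms unfolding sym_pos_semidef_def inner_compression
  by (simp add: matrix_transpose_mul matrix_mul_assoc)

lemma max_eigenvalue_compression_le:
  fixes A :: "real^'n^'n" and V :: "real^'k^'n"
  assumes sym: "transpose A = A" and V: "transpose V ** V = mat 1"
  shows "Max (eigenvalues (transpose V ** A ** V)) \<le> Max (eigenvalues A)"
proof (rule eigenvalue_le_Rayleigh_bound)
  show "Max (eigenvalues (transpose V ** A ** V)) \<in> eigenvalues (transpose V ** A ** V)"
    by (rule max_eigenvalue_symmetric(1)) (simp add: matrix_transpose_mul matrix_mul_assoc sym)
  show "x \<bullet> ((transpose V ** A ** V) *v x) \<le> Max (eigenvalues A) * (x \<bullet> x)" for x
  proof -
    \<comment> \<open>With the identity as compressed matrix, orthonormality of the columns says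
      that \<open>V\<close> is an isometry.\<close>
    have "(V *v x) \<bullet> (V *v x) = x \<bullet> x"
      using inner_compression[of x V "mat 1"] V by simp
    then show ?thesis
      unfolding inner_compression using max_eigenvalue_symmetric(2)[OF sym, of "V *v x"] by simp
  qed
qed

text \<open>A zero of a semi-definite form is a null vector of its matrix, and \<open>V\<close> is
  injective. This carries the absence of undamped rigid modes from the FOM to the ROM.\<close>

lemma zero_eigenvalue_compression:
  fixes A :: "real^'n^'n" and V :: "real^'k^'n"
  assumes A: "sym_pos_semidef A" and V: "transpose V ** V = mat 1"
    and "0 \<in> eigenvalues (transpose V ** A ** V)"
  shows "0 \<in> eigenvalues A"
proof -
  obtain x where x: "x \<noteq> 0" "(transpose V ** A ** V) *v x = 0"
    using assms(3) by (auto simp: eigenvalues_def)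
  have "A *v (V *v x) = 0"
    using inner_compression[of x V A] x(2) by (intro sym_pos_semidef_kernel[OF A]) simp
  moreover have "V *v x \<noteq> 0"
    using x(1) V by (metis matrix_vector_mul_assoc matrix_vector_mul_lid matrix_vector_mult_0_right)
  ultimately show ?thesis
    by (auto simp: eigenvalues_def)
qed

text \<open>\<open>R\<close> carries eigenvectors of \<open>S ** A ** R\<close> to eigenvectors of
  \<open>A\<close>.\<close>

lemma eigenvalues_similar_subset:
  fixes A R S :: "'a::field^'n^'n"
  assumes "R ** S = mat 1"
  shows "eigenvalues (S ** A ** R) \<subseteq> eigenvalues A"
proof
  fix \<mu> assume "\<mu> \<in> eigenvalues (S ** A ** R)"
  then obtain v where v: "v \<noteq> 0" "(S ** A ** R) *v v = \<mu> *s v"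
    by (auto simp: eigenvalues_def)
  have "S ** R = mat 1"
    using assms matrix_left_right_inverse by blast
  then have "R *v v \<noteq> 0"
    using v(1) by (metis matrix_vector_mul_assoc matrix_vector_mul_lid matrix_vector_mult_0_right)
  moreover have "A *v (R *v v) = R *v ((S ** A ** R) *v v)"
    by (simp add: matrix_vector_mul_assoc matrix_mul_assoc assms)
  ultimately show "\<mu> \<in> eigenvalues A"
    using v(2) by (auto simp: eigenvalues_def vector_scalar_commute)
qed

lemma eigenvalues_similar:
  fixes A R S :: "'a::field^'n^'n"
  assumes RS: "R ** S = mat 1"
  shows "eigenvalues (S ** A ** R) = eigenvalues A"
proof -
  have SR: "S ** R = mat 1"
    using RS matrix_left_right_inverse by blast
  have "R ** (S ** A ** R) ** S = R ** S ** A ** (R ** S)"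
    by (simp only: matrix_mul_assoc)
  then have "A = R ** (S ** A ** R) ** S"
    by (simp add: RS)
  then show ?thesis
    using eigenvalues_similar_subset[OF RS, of A] eigenvalues_similar_subset[OF SR, of "S ** A ** R"]
    by auto
qed

section \<open>The modal critical time step\<close>

text \<open>Companion form with trace \<open>s\<close> and determinant \<open>d\<close>: an
  eigenvector for \<open>z\<close> is a multiple of \<open>(z, 1)\<close>.\<close>

lemma eigenvalue_companion_iff:
  fixes s d z :: "'a::field"
  assumes "A = (vector [vector [s, - d], vector [1, 0]] :: 'a^2^2)"
  shows "z \<in> eigenvalues A \<longleftrightarrow> z\<^sup>2 - s * z + d = 0"
proof
  assume "z \<in> eigenvalues A"
  then obtain v where v: "v \<noteq> 0" "A *v v = z *s v"
    by (auto simp: eigenvalues_def)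
  moreover have "A *v v = z *s v \<longleftrightarrow> s * v $ 1 - d * v $ 2 = z * v $ 1 \<and> v $ 1 = z * v $ 2"
    by (simp add: assms vec_eq_iff forall_2 matrix_vector_mult_def sum_2)
  ultimately have e: "s * v $ 1 - d * v $ 2 = z * v $ 1" "v $ 1 = z * v $ 2"
    by blast+
  have "(z\<^sup>2 - s * z + d) * v $ 2 = 0"
    using e(1) unfolding e(2) by (simp add: algebra_simps power2_eq_square)
  moreover have "v $ 2 \<noteq> 0"
    using v(1) e(2) by (auto simp: vec_eq_iff forall_2)
  ultimately show "z\<^sup>2 - s * z + d = 0"
    by simp
next
  assume "z\<^sup>2 - s * z + d = 0"
  then have "A *v vector [z, 1] = z *s vector [z, 1]"
    by (simp add: assms vec_eq_iff forall_2 matrix_vector_mult_def sum_2 algebra_simps power2_eq_square)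
  moreover have "(vector [z, 1] :: 'a^2) \<noteq> 0"
    by (simp add: vec_eq_iff forall_2)
  ultimately show "z \<in> eigenvalues A"
    by (auto simp: eigenvalues_def)
qed

text \<open>The two roots are \<open>z\<close> and \<open>s - z\<close>, so \<open>z\<close> is
  simple as soon as they differ.\<close>

lemma algebraic_multiplicity_companion:
  fixes s d z :: "'a::field"
  assumes A: "A = (vector [vector [s, - d], vector [1, 0]] :: 'a^2^2)"
    and root: "z\<^sup>2 - s * z + d = 0" and simple: "2 * z \<noteq> s"
  shows "algebraic_multiplicity A z = 1"
proof -
  have "charpoly A = [:d, - s, 1:]"
    by (simp add: A charpoly_def det_2 map_matrix_def mat_def)
  also have "\<dots> = [:- z, 1:] * [:- (s - z), 1:]"
    using root by (simp add: algebra_simps power2_eq_square)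
  finally have p: "charpoly A = [:- z, 1:] * [:- (s - z), 1:]" .
  have "order z (charpoly A) = order z [:- z, 1:] + order z [:- (s - z), 1:]"
    unfolding p by (rule order_mult) (simp flip: p add: p)
  moreover have "order z [:- (s - z), 1:] = 0"
    using simple by (intro order_0I) (simp add: algebra_simps)
  moreover have "order z [:- z, 1:] = 1"
    using order_power_n_n[of z 1] by simp
  ultimately show ?thesis
    by (simp add: algebraic_multiplicity_def)
qed

text \<open>The upper right entry is written as a negated determinant to exhibit the companion
  form.\<close>

lemma complexified_amplification_matrix:
  "map_matrix complex_of_real (amplification_matrix \<mu> c h) =
     vector [vector [complex_of_real (2 - c * h - h\<^sup>2 * \<mu>), - complex_of_real (1 - c * h)],
             vector [1, 0]]"
  by (simp add: vec_eq_iff forall_2 map_matrix_def amplification_matrix_def)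

lemma stability_criterion_amplification_matrix:
  assumes "\<And>z. z\<^sup>2 - complex_of_real (2 - c * h - h\<^sup>2 * \<mu>) * z + complex_of_real (1 - c * h) = 0 \<Longrightarrow>
    cmod z \<le> 1 \<and> (cmod z = 1 \<longrightarrow> 2 * z \<noteq> complex_of_real (2 - c * h - h\<^sup>2 * \<mu>))"
  shows "stability_criterion (amplification_matrix \<mu> c h)"
  unfolding stability_criterion_def Let_def
  using assms eigenvalue_companion_iff[OF complexified_amplification_matrix]
    algebraic_multiplicity_companion[OF complexified_amplification_matrix]
  by blast

text \<open>Nonreal roots are conjugate with product \<open>1 - c * h\<close>, which is at most 1.
  Real roots are confined by the values of the characteristic polynomial at 1 and -1.\<close>

lemma amplification_matrix_stable:
  assumes "0 \<le> c" "0 \<le> \<mu>" and damped_or_stiff: "0 < c \<or> 0 < \<mu>"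
    and "0 < h" and h: "\<mu> * h\<^sup>2 + 2 * c * h < 4"
  shows "stability_criterion (amplification_matrix \<mu> c h)"
proof (rule stability_criterion_amplification_matrix)
  fix z :: complex
  define s where "s = 2 - c * h - h\<^sup>2 * \<mu>"
  define d where "d = 1 - c * h"
  assume "z\<^sup>2 - complex_of_real (2 - c * h - h\<^sup>2 * \<mu>) * z + complex_of_real (1 - c * h) = 0"
  then have z: "z\<^sup>2 - complex_of_real s * z + complex_of_real d = 0"
    by (simp only: s_def d_def)
  have ch: "0 \<le> c * h" and hm: "0 \<le> h\<^sup>2 * \<mu>"
    using assms by simp_all
  \<comment> \<open>This quantity is \<open>2 - s\<close>; its positivity keeps 1 from being a
    double root.\<close>
  have pos: "0 < c * h + h\<^sup>2 * \<mu>"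
    using damped_or_stiff ch hm \<open>0 < h\<close> by (auto intro: add_pos_nonneg add_nonneg_pos)
  have h': "2 * (c * h) + h\<^sup>2 * \<mu> < 4"
    using h by (simp add: algebra_simps)
  have re: "(Re z)\<^sup>2 - (Im z)\<^sup>2 - s * Re z + d = 0" and im: "Im z * (2 * Re z - s) = 0"
    using z by (auto simp: complex_eq_iff Re_power2 Im_power2 algebra_simps)
  show "cmod z \<le> 1 \<and> (cmod z = 1 \<longrightarrow> 2 * z \<noteq> complex_of_real (2 - c * h - h\<^sup>2 * \<mu>))"
  proof (cases "Im z = 0")
    case False
    then have "s = 2 * Re z"
      using im by simp
    with re have "(Re z)\<^sup>2 + (Im z)\<^sup>2 = d"
      by (simp add: power2_eq_square algebra_simps)
    then have "cmod z \<le> 1"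
      using ch by (simp add: cmod_def d_def)
    \<comment> \<open>Simplicity: \<open>2 * z\<close> is not real, while the trace is.\<close>
    with False show ?thesis
      by (auto simp: complex_eq_iff)
  next
    case True
    define x where "x = Re z"
    have zx: "z = complex_of_real x"
      using True by (simp add: x_def complex_eq_iff)
    have px: "x\<^sup>2 - s * x + d = 0"
      using re True by (simp add: x_def)
    have "\<not> x > 1"
    proof
      assume "x > 1"
      then have "0 < (x - 1) * (x + 1 - s)"
        using pos by (intro mult_pos_pos) (auto simp: s_def)
      \<comment> \<open>Expansion of the polynomial about 1.\<close>
      moreover have "x\<^sup>2 - s * x + d = h\<^sup>2 * \<mu> + (x - 1) * (x + 1 - s)"
        by (simp add: s_def d_def power2_eq_square algebra_simps)
      ultimately show False
        using px hm by linarith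
    qed
    moreover have "\<not> x \<le> -1"
    proof
      assume "x \<le> -1"
      then have "0 \<le> (x + 1) * (x - 1 - s)"
        using h' ch by (intro mult_nonpos_nonpos) (auto simp: s_def)
      \<comment> \<open>Expansion about -1, where the value is strictly positive by the bound on
        \<open>h\<close>; hence \<open>x = -1\<close> is excluded too.\<close>
      moreover have "x\<^sup>2 - s * x + d = (4 - 2 * (c * h) - h\<^sup>2 * \<mu>) + (x + 1) * (x - 1 - s)"
        by (simp add: s_def d_def power2_eq_square algebra_simps)
      ultimately show False
        using px h' by linarith
    qed
    moreover have "2 * x \<noteq> s" if "x = 1"
      using that pos by (simp add: s_def)
    moreover have "x = 1" if "\<bar>x\<bar> = 1"
      using that \<open>\<not> x \<le> -1\<close> by linarith
    ultimately have "\<bar>x\<bar> \<le> 1" and "\<bar>x\<bar> = 1 \<longrightarrow> 2 * x \<noteq> s"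
      by (linarith, blast)
    moreover have "2 * z = complex_of_real s \<longleftrightarrow> 2 * x = s"
      unfolding zx by (metis of_real_eq_iff of_real_mult of_real_numeral)
    ultimately show ?thesis
      by (simp add: zx flip: s_def del: of_real_diff)
  qed
qed

text \<open>The characteristic polynomial is negative at -1, so its smaller root is real and lies
  below -1.\<close>

lemma amplification_matrix_unstable:
  assumes h: "4 < \<mu> * h\<^sup>2 + 2 * c * h"
  shows "\<not> stability_criterion (amplification_matrix \<mu> c h)"
proof -
  define s where "s = 2 - c * h - h\<^sup>2 * \<mu>"
  define d where "d = 1 - c * h"
  define x where "x = (s - sqrt (s\<^sup>2 - 4 * d)) / 2"
  have "1 + s + d < 0"
    using h by (simp add: s_def d_def algebra_simps)
  then have disc: "(s + 2)\<^sup>2 < s\<^sup>2 - 4 * d"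
    by (simp add: power2_eq_square algebra_simps)
  then have "s + 2 < sqrt (s\<^sup>2 - 4 * d)"
    by (rule real_less_rsqrt)
  then have x: "x < -1"
    by (simp add: x_def)
  have "0 \<le> s\<^sup>2 - 4 * d"
    using disc zero_le_power2[of "s + 2"] by linarith
  moreover have "s - 2 * x = sqrt (s\<^sup>2 - 4 * d)"
    by (simp add: x_def field_simps)
  ultimately have "(s - 2 * x)\<^sup>2 = s\<^sup>2 - 4 * d"
    by simp
  then have "x\<^sup>2 - s * x + d = 0"
    by (simp add: power2_eq_square algebra_simps)
  then have "(complex_of_real x)\<^sup>2 - complex_of_real s * complex_of_real x + complex_of_real d = 0"
    by (metis of_real_0 of_real_add of_real_diff of_real_mult of_real_power)
  then have "complex_of_real x \<in> eigenvalues (map_matrix complex_of_real (amplification_matrix \<mu> c h))"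
    unfolding eigenvalue_companion_iff[OF complexified_amplification_matrix] s_def d_def .
  moreover have "\<not> cmod (complex_of_real x) \<le> 1"
    using x by simp
  ultimately show ?thesis
    unfolding stability_criterion_def Let_def by blast
qed

section \<open>Closed form of the modal critical time step\<close>

lemma modal_denominator_pos:
  fixes c \<mu> :: real
  assumes "0 \<le> c" "0 \<le> \<mu>" "0 < c \<or> 0 < \<mu>"
  shows "0 < c + sqrt (c\<^sup>2 + 4 * \<mu>)"
proof -
  have "0 < c\<^sup>2 + 4 * \<mu>"
    using assms by (auto intro: add_pos_nonneg add_nonneg_pos)
  then have "0 < sqrt (c\<^sup>2 + 4 * \<mu>)"
    by simp
  then show ?thesis
    using assms(1) by linarith
qed

text \<open>The value is the positive root of \<open>\<mu> * h\<^sup>2 + 2 * c * h = 4\<close>, in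
  the form that remains valid for \<open>\<mu> = 0\<close>. The left side increases strictly in
  \<open>h\<close>, which separates stable from unstable steps.\<close>

lemma modal_critical_time_step_formula:
  assumes "0 \<le> c" "0 \<le> \<mu>" "0 < c \<or> 0 < \<mu>"
  shows "modal_critical_time_step \<mu> c (4 / (c + sqrt (c\<^sup>2 + 4 * \<mu>)))"
proof -
  define r where "r = sqrt (c\<^sup>2 + 4 * \<mu>)"
  define T where "T = 4 / (c + r)"
  have r2: "r\<^sup>2 = c\<^sup>2 + 4 * \<mu>"
    using assms by (simp add: r_def)
  have cr: "0 < c + r"
    using modal_denominator_pos[OF assms] by (simp add: r_def)
  have T: "0 < T"
    using cr by (simp add: T_def)
  \<comment> \<open>The quadratic equation for \<open>T\<close>, multiplied by
    \<open>(c + r)\<^sup>2\<close>.\<close>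
  have *: "16 * \<mu> + 8 * c * (c + r) = 4 * (c + r)\<^sup>2"
    using r2 by (simp add: power2_eq_square algebra_simps)
  have root: "\<mu> * T\<^sup>2 + 2 * c * T = 4"
  proof -
    have "\<mu> * T\<^sup>2 + 2 * c * T = (16 * \<mu> + 8 * c * (c + r)) / (c + r)\<^sup>2"
      using cr unfolding T_def power_divide
      by (simp add: divide_simps) (simp add: power2_eq_square algebra_simps)
    also have "\<dots> = 4"
      using cr unfolding * by simp
    finally show ?thesis .
  qed
  have mono: "\<mu> * h\<^sup>2 + 2 * c * h < \<mu> * h'\<^sup>2 + 2 * c * h'" if "0 < h" "h < h'" for h h'
  proof -
    have "h\<^sup>2 < h'\<^sup>2"
      using that by (simp add: power_strict_mono)
    then have "\<mu> * h\<^sup>2 \<le> \<mu> * h'\<^sup>2" "0 < \<mu> \<longrightarrow> \<mu> * h\<^sup>2 < \<mu> * h'\<^sup>2"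
      using assms by (simp_all add: mult_left_mono)
    moreover have "2 * c * h \<le> 2 * c * h'" "0 < c \<longrightarrow> 2 * c * h < 2 * c * h'"
      using that assms by (simp_all add: mult_left_mono)
    ultimately show ?thesis
      using assms(3) by linarith
  qed
  show ?thesis
    unfolding modal_critical_time_step_def r_def[symmetric] T_def[symmetric]
  proof (intro conjI allI impI)
    show "0 < T"
      by (rule T)
    show "stability_criterion (amplification_matrix \<mu> c h)" if "0 < h \<and> h < T" for h
      using that mono[of h T] root by (intro amplification_matrix_stable assms) auto
    show "\<not> stability_criterion (amplification_matrix \<mu> c h)" if "T < h" for h
      using that mono[of T h] T root by (intro amplification_matrix_unstable) auto
  qed
qed

lemma modal_critical_value_antimono:
  fixes \<mu> \<nu> c d :: real
  assumes "0 \<le> c" "0 \<le> \<mu>" "0 < c \<or> 0 < \<mu>" and "c \<le> d" "\<mu> \<le> \<nu>"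
  shows "4 / (d + sqrt (d\<^sup>2 + 4 * \<nu>)) \<le> 4 / (c + sqrt (c\<^sup>2 + 4 * \<mu>))"
proof -
  have "c\<^sup>2 + 4 * \<mu> \<le> d\<^sup>2 + 4 * \<nu>"
    using assms power_mono[of c d 2] by linarith
  then have "sqrt (c\<^sup>2 + 4 * \<mu>) \<le> sqrt (d\<^sup>2 + 4 * \<nu>)"
    by (rule real_sqrt_le_mono)
  moreover have "0 < c + sqrt (c\<^sup>2 + 4 * \<mu>)"
    by (rule modal_denominator_pos[OF assms(1-3)])
  ultimately show ?thesis
    using assms(4) by (intro divide_left_mono mult_pos_pos) linarith+
qed

text \<open>Passes from the damping \<open>c\<close> to the damping ratio:
  \<open>sqrt (\<xi>\<^sup>2 + 1) - \<xi>\<close> is the reciprocal of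
  \<open>sqrt (\<xi>\<^sup>2 + 1) + \<xi>\<close>.\<close>

lemma modal_critical_value_damping_ratio:
  fixes \<mu> \<xi> :: real
  assumes "0 < \<mu>"
  shows "4 / (2 * \<xi> * sqrt \<mu> + sqrt ((2 * \<xi> * sqrt \<mu>)\<^sup>2 + 4 * \<mu>)) =
    2 / sqrt \<mu> * (sqrt (\<xi>\<^sup>2 + 1) - \<xi>)"
proof -
  define r where "r = sqrt (\<xi>\<^sup>2 + 1)"
  have "\<bar>\<xi>\<bar> < r"
    unfolding r_def by (rule real_less_rsqrt) simp
  then have pos: "0 < \<xi> + r"
    by linarith
  have "(2 * \<xi> * sqrt \<mu>)\<^sup>2 + 4 * \<mu> = (2 * sqrt \<mu>)\<^sup>2 * (\<xi>\<^sup>2 + 1)"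
    using assms by (simp add: power_mult_distrib algebra_simps)
  then have "sqrt ((2 * \<xi> * sqrt \<mu>)\<^sup>2 + 4 * \<mu>) = 2 * sqrt \<mu> * r"
    using assms by (simp add: real_sqrt_mult r_def)
  then have "4 / (2 * \<xi> * sqrt \<mu> + sqrt ((2 * \<xi> * sqrt \<mu>)\<^sup>2 + 4 * \<mu>)) =
      4 / (2 * sqrt \<mu> * (\<xi> + r))"
    by (simp add: algebra_simps)
  also have "\<dots> = 2 / sqrt \<mu> * (1 / (\<xi> + r))"
    by simp
  also have "1 / (\<xi> + r) = r - \<xi>"
  proof -
    have "r\<^sup>2 = \<xi>\<^sup>2 + 1"
      by (simp add: r_def)
    then have "(r - \<xi>) * (\<xi> + r) = 1"
      by (simp add: power2_eq_square algebra_simps)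
    then show ?thesis
      using pos by (simp add: divide_eq_eq)
  qed
  finally show ?thesis
    by (simp add: r_def)
qed

section \<open>Inverse matrices\<close>

lemma matrix_inv_left_right:
  fixes A :: "'a::semiring_1^'n^'m"
  assumes "invertible A"
  shows "A ** matrix_inv A = mat 1" "matrix_inv A ** A = mat 1"
  using someI_ex[OF assms[unfolded invertible_def]] by (simp_all add: matrix_inv_def)

lemma matrix_inv_eqI:
  fixes A B :: "'a::semiring_1^'n^'n"
  assumes "A ** B = mat 1" "B ** A = mat 1"
  shows "matrix_inv A = B"
proof -
  have "invertible A"
    using assms by (auto simp: invertible_def)
  then have "matrix_inv A = matrix_inv A ** (A ** B)" and "matrix_inv A ** A = mat 1"
    by (simp_all add: assms(1) matrix_inv_left_right)
  then show ?thesis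
    by (simp add: matrix_mul_assoc)
qed

section \<open>Systems with Rayleigh damping\<close>

text \<open>A nonzero \<open>\<phi>\<close> would be an undamped rigid mode: drift along it at
  constant velocity solves the unforced system and leaves every bound, however small the
  velocity.\<close>

lemma stable_system_no_rigid_mode:
  fixes M C K :: "real^'n^'n"
  assumes stable: "stable_system M C K" and \<phi>: "K *v \<phi> = 0" "C *v \<phi> = 0"
  shows "\<phi> = 0"
proof (rule ccontr)
  assume "\<phi> \<noteq> 0"
  obtain \<delta> B where "\<delta> > 0" and bound: "\<And>f x v y w t. system_solution M C K f x v \<Longrightarrow>
      system_solution M C K f y w \<Longrightarrow> norm (x 0 - y 0) + norm (v 0 - w 0) < \<delta> \<Longrightarrow> 0 \<le> t \<Longrightarrow>
      norm (x t - y t) \<le> B * (norm (x 0 - y 0) + norm (v 0 - w 0))"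
    using stable unfolding stable_system_def by metis
  \<comment> \<open>Gives the initial perturbation, here a velocity only, the size
    \<open>\<delta> / 2\<close>.\<close>
  define e where "e = \<delta> / (2 * norm \<phi>)"
  have e: "0 < e" "e * norm \<phi> < \<delta>"
    using \<open>\<delta> > 0\<close> \<open>\<phi> \<noteq> 0\<close> by (simp_all add: e_def)
  have drift: "system_solution M C K (\<lambda>_. 0) (\<lambda>t. t *\<^sub>R e *\<^sub>R \<phi>) (\<lambda>_. e *\<^sub>R \<phi>)"
    unfolding system_solution_def
    by (auto intro!: exI[of _ 0] derivative_eq_intros simp: matrix_vector_mult_scaleR \<phi>)
  have rest: "system_solution M C K (\<lambda>_. 0) (\<lambda>_. 0) (\<lambda>_. 0)"
    unfolding system_solution_def by (auto intro!: exI[of _ 0])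
  have "t * (e * norm \<phi>) \<le> B * (e * norm \<phi>)" if "0 \<le> t" for t
    using bound[OF drift rest _ that] e that by simp
  moreover have "0 < e * norm \<phi>"
    using e \<open>\<phi> \<noteq> 0\<close> by simp
  ultimately have "t \<le> B" if "0 \<le> t" for t
    using that by (metis mult_le_cancel_right_pos)
  from this[of "\<bar>B\<bar> + 1"] show False
    by linarith
qed

text \<open>For \<open>a1 = 0\<close> the damping is a multiple of \<open>K\<close>, so a null
  vector of \<open>K\<close> is a null vector of the damping as well.\<close>

lemma stable_Rayleigh_system_no_zero_eigenvalue:
  fixes M K :: "real^'n^'n"
  assumes "stable_system M (a1 *\<^sub>R M + a2 *\<^sub>R K) K" and "a1 = 0" and "invertible M"
  shows "0 \<notin> eigenvalues (matrix_inv M ** K)"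
proof
  assume "0 \<in> eigenvalues (matrix_inv M ** K)"
  then obtain \<phi> where \<phi>: "\<phi> \<noteq> 0" "(matrix_inv M ** K) *v \<phi> = 0"
    by (auto simp: eigenvalues_def)
  have "M ** (matrix_inv M ** K) = K"
    by (simp add: matrix_mul_assoc matrix_inv_left_right(1)[OF assms(3)])
  then have "K *v \<phi> = 0"
    using \<phi>(2) by (metis matrix_vector_mul_assoc matrix_vector_mult_0_right)
  then show False
    using stable_system_no_rigid_mode[OF assms(1), of \<phi>] \<phi>(1) assms(2)
    by (simp flip: scaleR_matrix_vector_assoc)
qed

text \<open>\<open>A\<close> is a symmetric substitute for \<open>matrix_inv M ** K\<close> with the
  same eigenvalues: the mass-scaled stiffness for the FOM, the reduced stiffness itself for the
  ROM.\<close>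

lemma has_critical_time_step_Rayleigh:
  fixes M K A :: "real^'n^'n"
  assumes "invertible M" and C: "C = a1 *\<^sub>R M + a2 *\<^sub>R K" and a: "0 \<le> a1" "0 \<le> a2"
    and A: "sym_pos_semidef A" and ev: "eigenvalues (matrix_inv M ** K) = eigenvalues A"
    and rigid: "a1 = 0 \<Longrightarrow> 0 \<notin> eigenvalues A"
    and \<mu>: "\<mu> = Max (eigenvalues A)" and c: "c = a1 + a2 * \<mu>"
  shows "has_critical_time_step M C K (4 / (c + sqrt (c\<^sup>2 + 4 * \<mu>)))"
proof -
  have sym: "transpose A = A"
    using A by (simp add: sym_pos_semidef_def)
  have modal: "modal_equations M C K = (\<lambda>\<mu>. (\<mu>, a1 + a2 * \<mu>)) ` eigenvalues A"
    using modal_equations_Rayleigh[OF assms(1) C] ev by simp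
  have nonneg: "0 \<le> \<nu>" if "\<nu> \<in> eigenvalues A" for \<nu>
    using eigenvalue_nonneg[OF A that] .
  \<comment> \<open>The eigenvalue 0 can occur only with \<open>0 < a1\<close>, and its mode then
    has damping \<open>a1\<close>.\<close>
  have pos: "0 < a1 + a2 * \<nu> \<or> 0 < \<nu>" if "\<nu> \<in> eigenvalues A" for \<nu>
    using that nonneg[OF that] rigid a by (cases "\<nu> = 0") (auto simp: less_le)
  have crit: "modal_critical_time_step \<nu> (a1 + a2 * \<nu>)
      (4 / (a1 + a2 * \<nu> + sqrt ((a1 + a2 * \<nu>)\<^sup>2 + 4 * \<nu>)))"
    if "\<nu> \<in> eigenvalues A" for \<nu>
    using nonneg[OF that] pos[OF that] a by (intro modal_critical_time_step_formula) auto
  have \<mu>_in: "\<mu> \<in> eigenvalues A"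
    unfolding \<mu> by (rule max_eigenvalue_symmetric(1)[OF sym])
  have "4 / (c + sqrt (c\<^sup>2 + 4 * \<mu>)) \<le> 4 / (a1 + a2 * \<nu> + sqrt ((a1 + a2 * \<nu>)\<^sup>2 + 4 * \<nu>))"
    if "\<nu> \<in> eigenvalues A" for \<nu>
  proof -
    have "\<nu> \<le> \<mu>"
      unfolding \<mu> using that finite_eigenvalues_symmetric[OF sym] by simp
    then show ?thesis
      using nonneg[OF that] pos[OF that] a unfolding c
      by (intro modal_critical_value_antimono) (auto intro: mult_left_mono)
  qed
  with crit crit[OF \<mu>_in] \<mu>_in show ?thesis
    unfolding has_critical_time_step_def modal c by fastforce
qed

section \<open>Diagonal mass matrices\<close>

lemma diag_inv_sqrt_symmetric: "transpose (diag_inv_sqrt M) = diag_inv_sqrt M"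
  by (auto simp: diag_inv_sqrt_def transpose_def vec_eq_iff)

lemma diagonal_matrix_mult:
  fixes a b :: "'n::finite \<Rightarrow> 'a::semiring_1"
  shows "(\<chi> i j. if i = j then a i else 0) ** (\<chi> i j. if i = j then b i else 0) =
    (\<chi> i j. if i = j then a i * b i else 0)"
proof -
  \<comment> \<open>Testing \<open>k = i\<close> with all else inside the branch lets the sum over
    \<open>k\<close> collapse to one term.\<close>
  have "(if i = k then a i else 0) * (if k = j then b k else 0) =
      (if k = i then a i * (if i = j then b i else 0) else 0)" for i j k
    by simp
  then show ?thesis
    by (simp add: vec_eq_iff matrix_matrix_mult_def)
qed

lemma diag_inv_sqrt_inverse:
  fixes M :: "real^'n^'n"
  assumes M: "diagonal M" "\<And>i. 0 < M $ i $ i"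
  shows "M ** (diag_inv_sqrt M ** diag_inv_sqrt M) = mat 1"
proof -
  define m where "m i = M $ i $ i" for i
  have "M = (\<chi> i j. if i = j then m i else 0)"
    using M(1) by (auto simp: diagonal_def vec_eq_iff m_def)
  moreover have "diag_inv_sqrt M = (\<chi> i j. if i = j then 1 / sqrt (m i) else 0)"
    unfolding diag_inv_sqrt_def m_def ..
  moreover have "m i * (1 / sqrt (m i) * (1 / sqrt (m i))) = 1" for i
    using M(2)[of i] by (simp add: m_def)
  ultimately show ?thesis
    by (simp only: diagonal_matrix_mult mat_def)
qed

text \<open>A critical time step presupposes a stable system, hence the stability premises;
  \<open>\<mu> > 0\<close> gives meaning to the quotients by \<open>sqrt \<mu>\<close> in the
  formula and in \<open>\<xi>\<close>.\<close>

theorem mainTheorem1: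
  fixes M K C :: "real^'m^'m" and V V_M :: "real^'k^'m" and C_ROM K_ROM :: "real^'k^'k"
    and a1 a2 \<mu> \<xi> :: real
  assumes "CARD('k) < CARD('m)"
    and "diagonal M" and "\<And>i. 0 < M $ i $ i"
    and "sym_pos_semidef K"
    and "0 \<le> a1" and "0 \<le> a2" and "C = a1 *\<^sub>R M + a2 *\<^sub>R K"
    and "transpose V ** V = mat 1"
    and "V_M = diag_inv_sqrt M ** V"
    and "transpose V_M ** M ** V_M = mat 1"
    and "C_ROM = transpose V_M ** C ** V_M"
    and "K_ROM = transpose V_M ** K ** V_M"
    and "\<mu> = Max (eigenvalues (transpose V ** diag_inv_sqrt M ** K ** diag_inv_sqrt M ** V))"
    and "\<xi> = a1 / (2 * sqrt \<mu>) + a2 * sqrt \<mu> / 2"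
  shows "(stable_system M C K \<longrightarrow>
            (\<exists>dt_FOM dt_ROM.
               has_critical_time_step M C K dt_FOM \<and>
               has_critical_time_step (mat 1) C_ROM K_ROM dt_ROM \<and>
               dt_ROM \<ge> dt_FOM))
       \<and> (stable_system (mat 1) C_ROM K_ROM \<longrightarrow> \<mu> > 0 \<longrightarrow>
            has_critical_time_step (mat 1) C_ROM K_ROM (2 / sqrt \<mu> * (sqrt (\<xi>\<^sup>2 + 1) - \<xi>)))"
proof -
  define S where "S = diag_inv_sqrt M"
  define A where "A = S ** K ** S"
  have S_sym: "transpose S = S"
    by (simp add: S_def diag_inv_sqrt_symmetric)
  have MSS: "M ** (S ** S) = mat 1"
    unfolding S_def by (rule diag_inv_sqrt_inverse[OF assms(2,3)])
  then have SSM: "S ** S ** M = mat 1"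
    using matrix_left_right_inverse by blast
  have inv: "invertible M"
    using MSS SSM by (auto simp: invertible_def)
  have M_inv: "matrix_inv M = S ** S"
    using MSS SSM by (rule matrix_inv_eqI)
  have A: "sym_pos_semidef A"
    using sym_pos_semidef_compression[OF assms(4), of S] by (simp add: S_sym A_def)
  then have A_sym: "transpose A = A"
    by (simp add: sym_pos_semidef_def)
  have "S ** (S ** M) = mat 1"
    using SSM by (simp add: matrix_mul_assoc)
  \<comment> \<open>\<open>S ** M\<close> is the inverse of \<open>S\<close>; this makes
    \<open>matrix_inv M ** K\<close> similar to \<open>A\<close>.\<close>
  then have SM: "S ** M ** S = mat 1"
    using matrix_left_right_inverse by blast
  have "matrix_inv M ** K = S ** A ** (S ** M)"
  proof -
    have "S ** A ** (S ** M) = S ** S ** K ** (S ** S ** M)"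
      by (simp only: A_def matrix_mul_assoc)
    then show ?thesis
      by (simp add: SSM M_inv)
  qed
  then have ev_FOM: "eigenvalues (matrix_inv M ** K) = eigenvalues A"
    by (simp add: eigenvalues_similar[OF SM])
  \<comment> \<open>The reduced stiffness is a compression of \<open>A\<close>, which brings the
    Rayleigh principle into play.\<close>
  have K_ROM: "K_ROM = transpose V ** A ** V"
    by (simp add: assms(9,12) A_def matrix_transpose_mul matrix_mul_assoc S_sym flip: S_def)
  have K_ROM_psd: "sym_pos_semidef K_ROM"
    unfolding K_ROM by (rule sym_pos_semidef_compression[OF A])
  have \<mu>: "\<mu> = Max (eigenvalues K_ROM)"
    by (simp add: assms(13) K_ROM A_def matrix_mul_assoc S_def)
  \<comment> \<open>Galerkin projection preserves Rayleigh damping, since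
    \<open>M\<close>-orthonormality turns the mass term into the identity.\<close>
  have C_ROM: "C_ROM = a1 *\<^sub>R mat 1 + a2 *\<^sub>R K_ROM"
  proof -
    have add: "(X + Y) ** Z = X ** Z + Y ** Z" for X Y :: "real^'m^'k" and Z :: "real^'k^'m"
      by (simp add: vec_eq_iff matrix_matrix_mult_def sum.distrib distrib_right)
    show ?thesis
      unfolding assms(11) assms(7)
      by (simp add: matrix_add_ldistrib add matrix_scalar_ac assms(10)
          flip: scalar_matrix_assoc assms(12))
  qed
  have inv1: "invertible (mat 1 :: real^'k^'k)"
    by (auto simp: invertible_def intro: exI[of _ "mat 1"])
  have ev_ROM: "eigenvalues (matrix_inv (mat 1) ** K_ROM) = eigenvalues K_ROM"
    by (simp add: matrix_inv_eqI[of "mat 1" "mat 1"])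
  define c where "c = a1 + a2 * \<mu>"
  have ROM: "has_critical_time_step (mat 1) C_ROM K_ROM (4 / (c + sqrt (c\<^sup>2 + 4 * \<mu>)))"
    if "a1 = 0 \<Longrightarrow> 0 \<notin> eigenvalues K_ROM"
    by (rule has_critical_time_step_Rayleigh
        [OF inv1 C_ROM assms(5,6) K_ROM_psd ev_ROM that \<mu> c_def])
  have "\<exists>dt_FOM dt_ROM. has_critical_time_step M C K dt_FOM \<and>
      has_critical_time_step (mat 1) C_ROM K_ROM dt_ROM \<and> dt_ROM \<ge> dt_FOM"
    if "stable_system M C K"
  proof -
    define \<nu> where "\<nu> = Max (eigenvalues A)"
    define d where "d = a1 + a2 * \<nu>"
    have A0: "0 \<notin> eigenvalues A" if "a1 = 0"
      using stable_Rayleigh_system_no_zero_eigenvalue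
        [OF \<open>stable_system M C K\<close>[unfolded assms(7)] that inv]
      unfolding ev_FOM .
    \<comment> \<open>Only the FOM is assumed stable here; the exclusion of rigid modes passes to
      the ROM by compression.\<close>
    have ROM0: "0 \<notin> eigenvalues K_ROM" if "a1 = 0"
      using zero_eigenvalue_compression[OF A assms(8)] A0[OF that] by (auto simp: K_ROM)
    have \<mu>_in: "\<mu> \<in> eigenvalues K_ROM"
      unfolding \<mu> using K_ROM_psd
      by (intro max_eigenvalue_symmetric(1)) (simp add: sym_pos_semidef_def)
    have \<mu>0: "0 \<le> \<mu>"
      by (rule eigenvalue_nonneg[OF K_ROM_psd \<mu>_in])
    have pos: "0 < c \<or> 0 < \<mu>"
      using \<mu>0 \<mu>_in ROM0 assms(5) by (cases "\<mu> = 0") (auto simp: c_def less_le)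
    have "\<mu> \<le> \<nu>"
      unfolding \<mu> \<nu>_def K_ROM by (rule max_eigenvalue_compression_le[OF A_sym assms(8)])
    then have "4 / (d + sqrt (d\<^sup>2 + 4 * \<nu>)) \<le> 4 / (c + sqrt (c\<^sup>2 + 4 * \<mu>))"
      using \<mu>0 pos assms(5,6)
      by (intro modal_critical_value_antimono) (auto simp: c_def d_def intro: mult_left_mono)
    moreover have "has_critical_time_step M C K (4 / (d + sqrt (d\<^sup>2 + 4 * \<nu>)))"
      by (rule has_critical_time_step_Rayleigh
          [OF inv assms(7,5,6) A ev_FOM A0 \<nu>_def d_def])
    ultimately show ?thesis
      using ROM[OF ROM0] by blast
  qed
  moreover have "has_critical_time_step (mat 1) C_ROM K_ROM (2 / sqrt \<mu> * (sqrt (\<xi>\<^sup>2 + 1) - \<xi>))"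
    if "stable_system (mat 1) C_ROM K_ROM" and "\<mu> > 0"
  proof -
    \<comment> \<open>Here rigid modes are excluded by the stability of the ROM itself.\<close>
    have "0 \<notin> eigenvalues K_ROM" if "a1 = 0"
      using stable_Rayleigh_system_no_zero_eigenvalue
        [OF \<open>stable_system (mat 1) C_ROM K_ROM\<close>[unfolded C_ROM] that inv1]
      unfolding ev_ROM .
    moreover have "c = 2 * \<xi> * sqrt \<mu>"
      using \<open>\<mu> > 0\<close> by (simp add: c_def assms(14) field_simps)
    ultimately show ?thesis
      using ROM modal_critical_value_damping_ratio[OF \<open>\<mu> > 0\<close>, of \<xi>] by simp
  qed
  ultimately show ?thesis
    by blast
qed

end
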